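(* Let $X$ be a Tychonoff space. Every prime ideal of the semiring $C_{+}(X)$ is contained in a unique maximal clique in $\Gamma(C_{+}(X))$.
   Context: For a Tychonoff space $X$, $C_{+}(X)$ is the commutative semiring of non-negative real-valued continuous functions on $X$ with pointwise operations. An ideal of a commutative semiring $S$ is a nonempty subset $I$ with $a+b\in I$ and $as\in I$ for all $a,b\in I$, $s\in S$; a prime ideal is a proper ideal $I$ such that $ab\in I$ implies $a\in I$ or $b\in I$. For $f\in C_{+}(X)$, $Z(f)=\{x\in X: f(x)=0\}$, and $\mathcal{N}'(X)$ is the set of non-units of $C_{+}(X)$ (functions with $Z(f)\neq\emptyset$). The zero-set intersection graph $\Gamma(C_{+}(X))$ has vertex set $\mathcal{N}'(X)$, with distinct vertices $f,g$ adjacent iff $Z(f)\cap Z(g)\neq\emptyset$. A clique is a nonempty set of vertices any two distinct members of which are adjacent; a maximal clique is a clique maximal with respect to inclusion. *)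

theory Defs
  imports
    "HOL-Analysis.Analysis"
    "HOL-Algebra.Ring"
    "HOL-Library.Ramsey"
begin

text \<open>HOL-Algebra defines ideals only for rings. In a commutative semiring, as here, one-sided
  absorption suffices; commutativity and the semiring laws are not built into the definitions.\<close>

definition semiring_ideal :: "'a set \<Rightarrow> ('a, 'm) ring_scheme \<Rightarrow> bool" where
  "semiring_ideal I S \<longleftrightarrow> I \<subseteq> carrier S \<and> I \<noteq> {} \<and>
     (\<forall>a\<in>I. \<forall>b\<in>I. a \<oplus>\<^bsub>S\<^esub> b \<in> I) \<and>
     (\<forall>a\<in>I. \<forall>s\<in>carrier S. a \<otimes>\<^bsub>S\<^esub> s \<in> I)"

definition prime_semiring_ideal :: "'a set \<Rightarrow> ('a, 'm) ring_scheme \<Rightarrow> bool" where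
  "prime_semiring_ideal I S \<longleftrightarrow> semiring_ideal I S \<and> I \<noteq> carrier S \<and>
     (\<forall>a\<in>carrier S. \<forall>b\<in>carrier S. a \<otimes>\<^bsub>S\<^esub> b \<in> I \<longrightarrow> a \<in> I \<or> b \<in> I)"

definition tychonoff_space :: "'a topology \<Rightarrow> bool" where
  "tychonoff_space X \<longleftrightarrow> completely_regular_space X \<and> Hausdorff_space X"

text \<open>Functions on the space are represented by their extensional extension to the whole type, so
  that HOL equality of carrier elements is equality of functions on \<open>topspace X\<close>.\<close>

definition C_plus :: "'a topology \<Rightarrow> ('a \<Rightarrow> real) ring" where
  "C_plus X =
     \<lparr>carrier = {f \<in> extensional (topspace X).
                  continuous_map X euclideanreal f \<and> (\<forall>x\<in>topspace X. 0 \<le> f x)},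
      monoid.mult = (\<lambda>f g. \<lambda>x\<in>topspace X. f x * g x),
      one = (\<lambda>x\<in>topspace X. 1),
      zero = (\<lambda>x\<in>topspace X. 0),
      add = (\<lambda>f g. \<lambda>x\<in>topspace X. f x + g x)\<rparr>"

definition zero_set :: "'a topology \<Rightarrow> ('a \<Rightarrow> real) \<Rightarrow> 'a set" where
  "zero_set X f = {x \<in> topspace X. f x = 0}"

definition nonunits :: "'a topology \<Rightarrow> ('a \<Rightarrow> real) set" where
  "nonunits X = carrier (C_plus X) - Units (C_plus X)"

text \<open>A simple graph is given by a vertex set and a set of two-element edges, as for \<^const>\<open>clique\<close>.\<close>

definition zero_set_graph_edges :: "'a topology \<Rightarrow> ('a \<Rightarrow> real) set set" where
  "zero_set_graph_edges X =
     {{f, g} | f g. f \<in> nonunits X \<and> g \<in> nonunits X \<and> f \<noteq> g \<and> zero_set X f \<inter> zero_set X g \<noteq> {}}"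

text \<open>The constant \<^const>\<open>clique\<close> admits the empty set and does not mention the vertex set of the
  graph; cliques here are nonempty sets of vertices.\<close>

definition graph_clique :: "'v set \<Rightarrow> 'v set set \<Rightarrow> 'v set \<Rightarrow> bool" where
  "graph_clique V E K \<longleftrightarrow> K \<noteq> {} \<and> K \<subseteq> V \<and> clique K E"

definition maximal_clique :: "'v set \<Rightarrow> 'v set set \<Rightarrow> 'v set \<Rightarrow> bool" where
  "maximal_clique V E K \<longleftrightarrow> graph_clique V E K \<and>
     (\<forall>L. graph_clique V E L \<and> K \<subseteq> L \<longrightarrow> L = K)"

lemma C_plus_add_closed:
  assumes "f \<in> carrier (C_plus X)" "g \<in> carrier (C_plus X)"
  shows "f \<oplus>\<^bsub>C_plus X\<^esub> g \<in> carrier (C_plus X)"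
proof -
  have "continuous_map X euclideanreal (\<lambda>x\<in>topspace X. f x + g x)"
    by (rule continuous_map_eq[where f = "\<lambda>x. f x + g x"])
      (use assms in \<open>auto simp: C_plus_def intro!: continuous_map_add\<close>)
  then show ?thesis using assms by (simp add: C_plus_def)
qed

lemma C_plus_mult_closed:
  assumes "f \<in> carrier (C_plus X)" "g \<in> carrier (C_plus X)"
  shows "f \<otimes>\<^bsub>C_plus X\<^esub> g \<in> carrier (C_plus X)"
proof -
  have "continuous_map X euclideanreal (\<lambda>x\<in>topspace X. f x * g x)"
    by (rule continuous_map_eq[where f = "\<lambda>x. f x * g x"])
      (use assms in \<open>auto simp: C_plus_def intro!: continuous_map_real_mult\<close>)
  then show ?thesis using assms by (simp add: C_plus_def)
qed

lemma C_plus_const_closed: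
  assumes "0 \<le> c"
  shows "(\<lambda>x\<in>topspace X. c) \<in> carrier (C_plus X)"
proof -
  have "continuous_map X euclideanreal (\<lambda>x\<in>topspace X. c)"
    by (rule continuous_map_eq[where f = "\<lambda>x. c"]) auto
  then show ?thesis using assms by (simp add: C_plus_def)
qed

lemma C_plus_simps:
  "f \<oplus>\<^bsub>C_plus X\<^esub> g = (\<lambda>x\<in>topspace X. f x + g x)"
  "f \<otimes>\<^bsub>C_plus X\<^esub> g = (\<lambda>x\<in>topspace X. f x * g x)"
  "\<zero>\<^bsub>C_plus X\<^esub> = (\<lambda>x\<in>topspace X. 0)"
  "\<one>\<^bsub>C_plus X\<^esub> = (\<lambda>x\<in>topspace X. 1)"
  by (simp_all add: C_plus_def)

lemma C_plus_restrict:
  assumes "f \<in> carrier (C_plus X)"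
  shows "restrict f (topspace X) = f"
  using assms by (simp add: C_plus_def extensional_restrict)

lemma C_plus_semiring: "semiring (C_plus X)"
proof (rule semiring.intro)
  show "abelian_monoid (C_plus X)"
  proof (rule abelian_monoidI)
    show "\<zero>\<^bsub>C_plus X\<^esub> \<in> carrier (C_plus X)"
      unfolding C_plus_simps by (rule C_plus_const_closed) simp
  qed (erule (1) C_plus_add_closed
      | simp add: C_plus_simps add_ac C_plus_restrict cong: restrict_cong)+
  show "monoid (C_plus X)"
  proof (rule monoidI)
    show "\<one>\<^bsub>C_plus X\<^esub> \<in> carrier (C_plus X)"
      unfolding C_plus_simps by (rule C_plus_const_closed) simp
  qed (erule (1) C_plus_mult_closed
      | simp add: C_plus_simps mult_ac C_plus_restrict cong: restrict_cong)+
  show "semiring_axioms (C_plus X)"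
    by (rule semiring_axioms.intro)
      (simp_all add: C_plus_simps distrib_left distrib_right cong: restrict_cong)
qed

lemma C_plus_comm_monoid: "comm_monoid (C_plus X)"
proof -
  have "monoid (C_plus X)"
    using C_plus_semiring by (rule semiring.axioms)
  then show ?thesis
    by (rule monoid.monoid_comm_monoidI) (simp add: C_plus_simps mult.commute)
qed

lemma nonunits_iff:
  "f \<in> nonunits X \<longleftrightarrow> f \<in> carrier (C_plus X) \<and> zero_set X f \<noteq> {}"
proof (cases "f \<in> carrier (C_plus X)")
  case True
  have "f \<in> Units (C_plus X) \<longleftrightarrow> zero_set X f = {}"
  proof
    assume "f \<in> Units (C_plus X)"
    then obtain g where "(\<lambda>x\<in>topspace X. f x * g x) = (\<lambda>x\<in>topspace X. 1)"
      unfolding Units_def C_plus_simps by blast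
    then have "f x * g x = 1" if "x \<in> topspace X" for x
      using that by (auto dest: fun_cong[of _ _ x])
    then show "zero_set X f = {}"
      by (force simp: zero_set_def)
  next
    assume z: "zero_set X f = {}"
    define g where "g = (\<lambda>x\<in>topspace X. inverse (f x))"
    have "continuous_map X euclideanreal g"
      by (rule continuous_map_eq[where f = "\<lambda>x. inverse (f x)"])
        (use True z in \<open>auto simp: g_def C_plus_def zero_set_def intro!: continuous_map_real_inverse\<close>)
    then have "g \<in> carrier (C_plus X)"
      using True by (auto simp: g_def C_plus_def)
    moreover have "(\<lambda>x\<in>topspace X. g x * f x) = (\<lambda>x\<in>topspace X. 1)"
      using z by (auto simp: g_def zero_set_def fun_eq_iff)
    moreover from this have "(\<lambda>x\<in>topspace X. f x * g x) = (\<lambda>x\<in>topspace X. 1)"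
      by (simp add: mult.commute)
    ultimately show "f \<in> Units (C_plus X)"
      using True unfolding Units_def C_plus_simps by blast
  qed
  with True show ?thesis by (simp add: nonunits_def)
qed (simp add: nonunits_def)

end

theory Submission
  imports Defs
begin

text \<open>Since \<open>Z(f + g) = Z(f) \<inter> Z(g)\<close>, a proper ideal is a clique, and Zorn's lemma extends it to a
  maximal one. For uniqueness, let \<open>M\<close> and \<open>M'\<close> be maximal cliques containing the prime ideal \<open>P\<close>
  and let \<open>f \<in> M - M'\<close>. By maximality \<open>Z(f) \<inter> Z(g) = {}\<close> for some \<open>g \<in> M'\<close>. The product of the
  positive parts of \<open>f - g\<close> and \<open>g - f\<close> is \<open>0 \<in> P\<close>, so one of them lies in \<open>P\<close>; but the first
  has no common zero with \<open>g\<close> and the second none with \<open>f\<close>.\<close>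

text \<open>Zorn's lemma on the cliques above \<open>K\<close>: being a clique is a condition on
  pairs, and any two vertices of the union of a chain already lie in a single member of it.\<close>

lemma graph_clique_subset_maximal_clique:
  assumes "graph_clique V E K"
  obtains M where "maximal_clique V E M" "K \<subseteq> M"
proof -
  let ?A = "{L. graph_clique V E L \<and> K \<subseteq> L}"
  have "\<exists>M\<in>?A. \<forall>L\<in>?A. M \<subseteq> L \<longrightarrow> L = M"
  proof (rule subset_Zorn_nonempty)
    show "?A \<noteq> {}"
      using assms by blast
  next
    fix C
    assume "C \<noteq> {}" and C: "subset.chain ?A C"
    then have "K \<subseteq> \<Union>C" "K \<noteq> {}" "\<Union>C \<subseteq> V"
      using assms unfolding graph_clique_def subset_chain_def by blast+
    moreover have "clique (\<Union>C) E"
      unfolding clique_def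
    proof (intro ballI impI)
      fix v w
      assume "v \<in> \<Union>C" "w \<in> \<Union>C" "v \<noteq> w"
      then obtain L where "L \<in> C" "v \<in> L" "w \<in> L"
        using C by (auto simp: subset_chain_def) (meson subsetD)
      moreover from this have "clique L E"
        using C by (auto simp: subset_chain_def graph_clique_def)
      ultimately show "{v, w} \<in> E"
        using \<open>v \<noteq> w\<close> by (simp add: clique_def)
    qed
    ultimately show "\<Union>C \<in> ?A"
      by (auto simp: graph_clique_def)
  qed
  then show ?thesis
    using that unfolding maximal_clique_def by (metis (mono_tags, lifting) mem_Collect_eq order_trans)
qed

lemma zero_set_edge_iff:
  "{f, g} \<in> zero_set_graph_edges X \<longleftrightarrow>
     f \<in> nonunits X \<and> g \<in> nonunits X \<and> f \<noteq> g \<and> zero_set X f \<inter> zero_set X g \<noteq> {}"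
  by (auto simp: zero_set_graph_edges_def doubleton_eq_iff)

text \<open>Edges only join distinct vertices; for \<open>f = g\<close> the intersection is
  \<open>zero_set X f\<close>, which is nonempty because vertices are non-units.\<close>

lemma graph_clique_zero_sets_meet:
  assumes "graph_clique (nonunits X) (zero_set_graph_edges X) K" "f \<in> K" "g \<in> K"
  shows "zero_set X f \<inter> zero_set X g \<noteq> {}"
proof (cases "f = g")
  case True
  then show ?thesis
    using assms by (auto simp: graph_clique_def nonunits_iff)
next
  case False
  then have "{f, g} \<in> zero_set_graph_edges X"
    using assms by (simp add: graph_clique_def clique_def)
  then show ?thesis
    by (simp add: zero_set_edge_iff)
qed

text \<open>A sum of non-negative reals vanishes only if both summands do.\<close>

lemma zero_set_add:
  assumes "f \<in> carrier (C_plus X)" "g \<in> carrier (C_plus X)"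
  shows "zero_set X (f \<oplus>\<^bsub>C_plus X\<^esub> g) = zero_set X f \<inter> zero_set X g"
  using assms by (auto simp: zero_set_def C_plus_simps C_plus_def add_nonneg_eq_0_iff)

lemma (in semiring) proper_semiring_ideal_disjoint_Units:
  assumes "semiring_ideal I R" "I \<noteq> carrier R"
  shows "I \<inter> Units R = {}"
proof (rule ccontr)
  have absorb: "a \<otimes> s \<in> I" if "a \<in> I" "s \<in> carrier R" for a s
    using assms that by (auto simp: semiring_ideal_def)
  assume "I \<inter> Units R \<noteq> {}"
  then obtain u where u: "u \<in> I" "u \<in> Units R"
    by blast
  then have "\<one> \<in> I"
    using absorb[of u "inv u"] by simp
  then have "carrier R \<subseteq> I"
    using absorb[of \<one>] by auto
  then show False
    using assms by (auto simp: semiring_ideal_def)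
qed

lemma proper_ideal_graph_clique:
  assumes "semiring_ideal I (C_plus X)" "I \<noteq> carrier (C_plus X)"
  shows "graph_clique (nonunits X) (zero_set_graph_edges X) I"
proof -
  interpret semiring "C_plus X"
    by (rule C_plus_semiring)
  have sub: "I \<subseteq> nonunits X"
    using proper_semiring_ideal_disjoint_Units[OF assms] assms(1)
    by (auto simp: nonunits_def semiring_ideal_def)
  have "{f, g} \<in> zero_set_graph_edges X" if "f \<in> I" "g \<in> I" "f \<noteq> g" for f g
  proof -
    \<comment> \<open>The sum stays in \<open>I\<close>, so it is a non-unit; any zero of it is a
      common zero of \<open>f\<close> and \<open>g\<close>.\<close>
    have "f \<oplus>\<^bsub>C_plus X\<^esub> g \<in> nonunits X"
      using assms(1) sub that by (auto simp: semiring_ideal_def)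
    moreover have "f \<in> carrier (C_plus X)" "g \<in> carrier (C_plus X)"
      using sub that by (auto simp: nonunits_def)
    ultimately show ?thesis
      using sub that by (auto simp: zero_set_edge_iff nonunits_iff zero_set_add)
  qed
  then show ?thesis
    using sub assms(1) by (simp add: graph_clique_def clique_def semiring_ideal_def)
qed

lemma C_plus_pos_part_diff_closed:
  assumes "f \<in> carrier (C_plus X)" "g \<in> carrier (C_plus X)"
  shows "(\<lambda>x\<in>topspace X. max 0 (f x - g x)) \<in> carrier (C_plus X)"
proof -
  have "continuous_map X euclideanreal (\<lambda>x\<in>topspace X. max 0 (f x - g x))"
    by (rule continuous_map_eq[where f = "\<lambda>x. max 0 (f x - g x)"])
      (use assms in \<open>auto simp: C_plus_def intro!: continuous_map_real_max continuous_map_diff\<close>)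
  then show ?thesis
    by (simp add: C_plus_def)
qed

text \<open>At a zero of \<open>g\<close> the truncated difference equals \<open>f x\<close>, since
  \<open>f\<close> is non-negative, so a common zero would also be a zero of
  \<open>f\<close>.\<close>

lemma zero_set_pos_part_diff_disjoint:
  assumes "f \<in> carrier (C_plus X)" "zero_set X f \<inter> zero_set X g = {}"
  shows "zero_set X (\<lambda>x\<in>topspace X. max 0 (f x - g x)) \<inter> zero_set X g = {}"
  using assms by (force simp: zero_set_def C_plus_def max_def split: if_splits)

lemma prime_ideal_pos_part_cases:
  assumes P: "prime_semiring_ideal P (C_plus X)"
    and f: "f \<in> carrier (C_plus X)" and g: "g \<in> carrier (C_plus X)"
  shows "(\<lambda>x\<in>topspace X. max 0 (f x - g x)) \<in> P \<or> (\<lambda>x\<in>topspace X. max 0 (g x - f x)) \<in> P"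
    (is "?h \<in> P \<or> ?k \<in> P")
proof -
  obtain p where "p \<in> P"
    using P by (auto simp: prime_semiring_ideal_def semiring_ideal_def)
  \<comment> \<open>The definition of an ideal does not mention zero; absorption puts it into
    \<open>P\<close>.\<close>
  then have "p \<otimes>\<^bsub>C_plus X\<^esub> (\<lambda>x\<in>topspace X. 0) \<in> P"
    using P C_plus_const_closed[of 0 X]
    by (auto simp: prime_semiring_ideal_def semiring_ideal_def)
  moreover have "p \<otimes>\<^bsub>C_plus X\<^esub> (\<lambda>x\<in>topspace X. 0) = ?h \<otimes>\<^bsub>C_plus X\<^esub> ?k"
    by (auto simp: C_plus_simps max_def fun_eq_iff)
  ultimately have "?h \<otimes>\<^bsub>C_plus X\<^esub> ?k \<in> P"
    by simp
  with P show ?thesis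
    using C_plus_pos_part_diff_closed[OF f g] C_plus_pos_part_diff_closed[OF g f]
    unfolding prime_semiring_ideal_def by blast
qed

text \<open>Otherwise \<open>insert f M\<close> would be a strictly larger clique.\<close>

lemma maximal_clique_zero_set_disjoint:
  assumes M: "maximal_clique (nonunits X) (zero_set_graph_edges X) M"
    and f: "f \<in> nonunits X" "f \<notin> M"
  obtains g where "g \<in> M" "zero_set X f \<inter> zero_set X g = {}"
proof (rule ccontr)
  assume "\<not> thesis"
  with that have "zero_set X f \<inter> zero_set X g \<noteq> {}" if "g \<in> M" for g
    using \<open>g \<in> M\<close> by blast
  then have "graph_clique (nonunits X) (zero_set_graph_edges X) (insert f M)"
    using M f
    by (auto simp: maximal_clique_def graph_clique_def clique_def zero_set_edge_iff Int_commute)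
  then show False
    using M f by (auto simp: maximal_clique_def)
qed

text \<open>Applied to two maximal cliques over \<open>P\<close>, this forces them to be
  equal.\<close>

lemma clique_subset_maximal_clique_over_prime:
  assumes P: "prime_semiring_ideal P (C_plus X)"
    and K: "graph_clique (nonunits X) (zero_set_graph_edges X) K" "P \<subseteq> K"
    and M: "maximal_clique (nonunits X) (zero_set_graph_edges X) M" "P \<subseteq> M"
  shows "K \<subseteq> M"
proof (rule ccontr)
  have M': "graph_clique (nonunits X) (zero_set_graph_edges X) M"
    using M by (simp add: maximal_clique_def)
  assume "\<not> K \<subseteq> M"
  then obtain f where f: "f \<in> K" "f \<notin> M"
    by blast
  then have fn: "f \<in> nonunits X"
    using K by (auto simp: graph_clique_def)
  obtain g where g: "g \<in> M" and disj: "zero_set X f \<inter> zero_set X g = {}"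
    using maximal_clique_zero_set_disjoint[OF M(1) fn f(2)] .
  then have carr: "f \<in> carrier (C_plus X)" "g \<in> carrier (C_plus X)"
    using fn M' by (auto simp: graph_clique_def nonunits_def)
  from prime_ideal_pos_part_cases[OF P carr] show False
  proof
    \<comment> \<open>This function lies in \<open>M\<close> together with \<open>g\<close>,
      although their zero sets are disjoint.\<close>
    assume "(\<lambda>x\<in>topspace X. max 0 (f x - g x)) \<in> P"
    then show False
      using graph_clique_zero_sets_meet[OF M' _ g] zero_set_pos_part_diff_disjoint[OF carr(1) disj] M(2)
      by blast
  next
    \<comment> \<open>With the roles exchanged, the clash with \<open>f\<close> occurs in
      \<open>K\<close>.\<close>
    assume "(\<lambda>x\<in>topspace X. max 0 (g x - f x)) \<in> P"
    then show False
      using graph_clique_zero_sets_meet[OF K(1) _ f(1)] K(2)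
        zero_set_pos_part_diff_disjoint[OF carr(2), of f] disj
      by blast
  qed
qed

theorem theorem3p12:
  fixes X :: "'a topology" and P :: "('a \<Rightarrow> real) set"
  assumes "tychonoff_space X"
    and "prime_semiring_ideal P (C_plus X)"
  shows "\<exists>!M. maximal_clique (nonunits X) (zero_set_graph_edges X) M \<and> P \<subseteq> M"
proof -
  have "graph_clique (nonunits X) (zero_set_graph_edges X) P"
    using assms(2) by (simp add: prime_semiring_ideal_def proper_ideal_graph_clique)
  then obtain M where "maximal_clique (nonunits X) (zero_set_graph_edges X) M" "P \<subseteq> M"
    by (rule graph_clique_subset_maximal_clique)
  moreover have "K = L"
    if "maximal_clique (nonunits X) (zero_set_graph_edges X) K" "P \<subseteq> K"
      "maximal_clique (nonunits X) (zero_set_graph_edges X) L" "P \<subseteq> L" for K L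
    using clique_subset_maximal_clique_over_prime[OF assms(2)] that
    by (simp add: maximal_clique_def)
  ultimately show ?thesis
    by blast
qed

end
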